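(* Let $R$ be a ring with identity (not necessarily commutative) and let $\mathcal M$ be a class of left $R$-modules closed under taking submodules and quotient modules. For a residual operation $r$ on $\mathcal M$ put $\sigma(r)(M) := 0^r_M$ for $M\in\mathcal M$. For a submodule selector $\alpha$ on $\mathcal M$ put $L^{\rho(\alpha)}_M := \pi^{-1}(\alpha(M/L))$ for $L\subseteq M$ in $\mathcal M$, where $\pi: M\to M/L$ is the natural surjection. Then $\sigma$ is a bijection from the residual operations on $\mathcal M$ to the submodule selectors on $\mathcal M$, with inverse given by $\rho$.
   Context: $\mathcal P$ denotes the collection of pairs $(L,M)$ with $M\in\mathcal M$ and $L$ a submodule of $M$ (so $L \in \mathcal M$). A submodule selector on $\mathcal M$ is a function $\alpha:\mathcal M\to\mathcal M$ such that $\alpha(M)$ is a submodule of $M$ for every $M\in\mathcal M$, and $\varphi(\alpha(M))=\alpha(N)$ for every isomorphism $\varphi:M\to N$ between modules in $\mathcal M$. An extensive operation on $\mathcal M$ is a function $e:\mathcal P\to\mathcal M$, written $L^e_M:=e(L,M)$, such that $L\subseteq L^e_M\subseteq M$ for all $(L,M)\in\mathcal P$ (with $L^e_M$ a submodule), and $\varphi(L^e_M)=\varphi(L)^e_N$ for every isomorphism $\varphi:M\to N$ in $\mathcal M$ and every submodule $L\subseteq M$. A residual operation on $\mathcal M$ is an extensive operation $r$ such that for every surjective map $q:M\to P$ in $\mathcal M$, $(\ker q)^r_M=q^{-1}(0^r_P)$. *)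

theory Defs
  imports "HOL-Algebra.Module" "HOL-Algebra.AbelCoset" "HOL-Library.FuncSet"
begin

section \<open>Left modules over a ring that need not be commutative\<close>

text \<open>
  The library locale \<^locale>\<open>module\<close> demands a commutative ring, so the same axioms are stated
  here over \<^locale>\<open>ring\<close>.  As there, the record fields for the product and the unit of the module
  are unused, and a submodule is a set \<open>H\<close> with \<^term>\<open>submodule H R M\<close>; as a module in its own
  right it is \<^term>\<open>M\<lparr>carrier := H\<rparr>\<close>.
\<close>

locale left_module = R?: ring R + M?: abelian_group M
  for R :: "('r, 'x) ring_scheme" (structure)
    and M :: "('r, 'm, 'y) module_scheme" (structure) +
  assumes smult_closed:
      "\<lbrakk>a \<in> carrier R; x \<in> carrier M\<rbrakk> \<Longrightarrow> a \<odot>\<^bsub>M\<^esub> x \<in> carrier M"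
    and smult_l_distr:
      "\<lbrakk>a \<in> carrier R; b \<in> carrier R; x \<in> carrier M\<rbrakk> \<Longrightarrow>
        (a \<oplus>\<^bsub>R\<^esub> b) \<odot>\<^bsub>M\<^esub> x = (a \<odot>\<^bsub>M\<^esub> x) \<oplus>\<^bsub>M\<^esub> (b \<odot>\<^bsub>M\<^esub> x)"
    and smult_r_distr:
      "\<lbrakk>a \<in> carrier R; x \<in> carrier M; y \<in> carrier M\<rbrakk> \<Longrightarrow>
        a \<odot>\<^bsub>M\<^esub> (x \<oplus>\<^bsub>M\<^esub> y) = (a \<odot>\<^bsub>M\<^esub> x) \<oplus>\<^bsub>M\<^esub> (a \<odot>\<^bsub>M\<^esub> y)"
    and smult_assoc:
      "\<lbrakk>a \<in> carrier R; b \<in> carrier R; x \<in> carrier M\<rbrakk> \<Longrightarrow>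
        (a \<otimes>\<^bsub>R\<^esub> b) \<odot>\<^bsub>M\<^esub> x = a \<odot>\<^bsub>M\<^esub> (b \<odot>\<^bsub>M\<^esub> x)"
    and smult_one:
      "x \<in> carrier M \<Longrightarrow> \<one>\<^bsub>R\<^esub> \<odot>\<^bsub>M\<^esub> x = x"

definition lmod_hom ::
    "('r, 'x) ring_scheme \<Rightarrow> ('r, 'm) module \<Rightarrow> ('r, 'n) module \<Rightarrow> ('m \<Rightarrow> 'n) set" where
  "lmod_hom R M N = {f \<in> carrier M \<rightarrow> carrier N.
     (\<forall>x\<in>carrier M. \<forall>y\<in>carrier M. f (x \<oplus>\<^bsub>M\<^esub> y) = f x \<oplus>\<^bsub>N\<^esub> f y) \<and>
     (\<forall>a\<in>carrier R. \<forall>x\<in>carrier M. f (a \<odot>\<^bsub>M\<^esub> x) = a \<odot>\<^bsub>N\<^esub> f x)}"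

definition lmod_epi ::
    "('r, 'x) ring_scheme \<Rightarrow> ('r, 'm) module \<Rightarrow> ('r, 'n) module \<Rightarrow> ('m \<Rightarrow> 'n) set" where
  "lmod_epi R M N = {f \<in> lmod_hom R M N. f ` carrier M = carrier N}"

definition lmod_iso ::
    "('r, 'x) ring_scheme \<Rightarrow> ('r, 'm) module \<Rightarrow> ('r, 'n) module \<Rightarrow> ('m \<Rightarrow> 'n) set" where
  "lmod_iso R M N = {f \<in> lmod_hom R M N. bij_betw f (carrier M) (carrier N)}"

section \<open>Quotient modules\<close>

definition coset_module :: "('r, 'm) module \<Rightarrow> 'm set \<Rightarrow> ('r, 'm set) module" where
  "coset_module M L =
     \<lparr>carrier = a_rcosets\<^bsub>M\<^esub> L, mult = undefined, one = undefined,
      zero = L, add = (<+>\<^bsub>M\<^esub>), smult = (\<lambda>a C. \<Union>x\<in>C. L +>\<^bsub>M\<^esub> (a \<odot>\<^bsub>M\<^esub> x))\<rparr>"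

text \<open>
  The elements of \<^term>\<open>coset_module M L\<close> are sets of elements of \<open>M\<close> and hence have a different
  type, while the modules of one class must share a type.  A function \<open>c\<close> that names each coset by
  an element of the original type, injectively on the cosets of \<open>L\<close>, turns the quotient into a
  module on that type.  In set theory a coset is itself an element of the universe, and
  \<open>c\<close> can be the identity.  Lemma \<open>inj_on_choice_code\<close> below shows that in HOL such a \<open>c\<close> always
  exists: the choice of a representative.
\<close>

definition transport_module :: "('m \<Rightarrow> 'n) \<Rightarrow> ('r, 'm) module \<Rightarrow> ('r, 'n) module" where
  "transport_module c N =
     (let d = the_inv_into (carrier N) c in
      \<lparr>carrier = c ` carrier N, mult = undefined, one = undefined,
       zero = c \<zero>\<^bsub>N\<^esub>, add = (\<lambda>u v. c (d u \<oplus>\<^bsub>N\<^esub> d v)), smult = (\<lambda>a u. c (a \<odot>\<^bsub>N\<^esub> d u))\<rparr>)"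

definition quot_module :: "('m set \<Rightarrow> 'm) \<Rightarrow> ('r, 'm) module \<Rightarrow> 'm set \<Rightarrow> ('r, 'm) module" where
  "quot_module c M L = transport_module c (coset_module M L)"

definition quot_proj :: "('m set \<Rightarrow> 'm) \<Rightarrow> ('r, 'm) module \<Rightarrow> 'm set \<Rightarrow> 'm \<Rightarrow> 'm" where
  "quot_proj c M L x = c (L +>\<^bsub>M\<^esub> x)"

section \<open>Classes of modules, submodule selectors, residual operations\<close>

definition closed_under_submodules ::
    "('r, 'x) ring_scheme \<Rightarrow> ('r, 'm) module set \<Rightarrow> bool" where
  "closed_under_submodules R \<M> \<longleftrightarrow>
     (\<forall>M\<in>\<M>. \<forall>L. submodule L R M \<longrightarrow> M\<lparr>carrier := L\<rparr> \<in> \<M>)"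

definition closed_under_quotients ::
    "('r, 'x) ring_scheme \<Rightarrow> ('m set \<Rightarrow> 'm) \<Rightarrow> ('r, 'm) module set \<Rightarrow> bool" where
  "closed_under_quotients R c \<M> \<longleftrightarrow>
     (\<forall>M\<in>\<M>. \<forall>L. submodule L R M \<longrightarrow> quot_module c M L \<in> \<M>)"

definition submodule_pairs ::
    "('r, 'x) ring_scheme \<Rightarrow> ('r, 'm) module set \<Rightarrow> ('m set \<times> ('r, 'm) module) set" where
  "submodule_pairs R \<M> = {(L, M). M \<in> \<M> \<and> submodule L R M}"

text \<open>
  The functions in the next two definitions are required to be \<^const>\<open>extensional\<close>, so that
  equality of HOL functions is equality of functions on \<open>\<M>\<close>, respectively on the pairs.
\<close>

definition submodule_selectors ::
    "('r, 'x) ring_scheme \<Rightarrow> ('r, 'm) module set \<Rightarrow> (('r, 'm) module \<Rightarrow> 'm set) set" where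
  "submodule_selectors R \<M> = {\<alpha> \<in> extensional \<M>.
     (\<forall>M\<in>\<M>. submodule (\<alpha> M) R M \<and> M\<lparr>carrier := \<alpha> M\<rparr> \<in> \<M>) \<and>
     (\<forall>M\<in>\<M>. \<forall>N\<in>\<M>. \<forall>\<phi>\<in>lmod_iso R M N. \<phi> ` \<alpha> M = \<alpha> N)}"

definition extensive_operations ::
    "('r, 'x) ring_scheme \<Rightarrow> ('r, 'm) module set \<Rightarrow>
     ('m set \<times> ('r, 'm) module \<Rightarrow> 'm set) set" where
  "extensive_operations R \<M> = {e \<in> extensional (submodule_pairs R \<M>).
     (\<forall>(L, M)\<in>submodule_pairs R \<M>.
        L \<subseteq> e (L, M) \<and> submodule (e (L, M)) R M \<and> M\<lparr>carrier := e (L, M)\<rparr> \<in> \<M>) \<and>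
     (\<forall>M\<in>\<M>. \<forall>N\<in>\<M>. \<forall>\<phi>\<in>lmod_iso R M N. \<forall>L. submodule L R M \<longrightarrow>
        \<phi> ` e (L, M) = e (\<phi> ` L, N))}"

definition residual_operations ::
    "('r, 'x) ring_scheme \<Rightarrow> ('r, 'm) module set \<Rightarrow>
     ('m set \<times> ('r, 'm) module \<Rightarrow> 'm set) set" where
  "residual_operations R \<M> = {r \<in> extensive_operations R \<M>.
     \<forall>M\<in>\<M>. \<forall>P\<in>\<M>. \<forall>q\<in>lmod_epi R M P.
       r (a_kernel M P q, M) = {x \<in> carrier M. q x \<in> r ({\<zero>\<^bsub>P\<^esub>}, P)}}"

definition selector_of ::
    "('r, 'm) module set \<Rightarrow> ('m set \<times> ('r, 'm) module \<Rightarrow> 'm set) \<Rightarrow>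
     ('r, 'm) module \<Rightarrow> 'm set" where
  "selector_of \<M> r = (\<lambda>M\<in>\<M>. r ({\<zero>\<^bsub>M\<^esub>}, M))"

definition residual_of ::
    "('r, 'x) ring_scheme \<Rightarrow> ('m set \<Rightarrow> 'm) \<Rightarrow> ('r, 'm) module set \<Rightarrow>
     (('r, 'm) module \<Rightarrow> 'm set) \<Rightarrow> 'm set \<times> ('r, 'm) module \<Rightarrow> 'm set" where
  "residual_of R c \<M> \<alpha> = (\<lambda>(L, M)\<in>submodule_pairs R \<M>.
     {x \<in> carrier M. quot_proj c M L x \<in> \<alpha> (quot_module c M L)})"

section \<open>The quotient construction is sound\<close>

lemma inj_on_choice_code:
  assumes "abelian_group M" and "subgroup L (add_monoid M)"
  shows "inj_on (\<lambda>C. SOME x. x \<in> C) (a_rcosets\<^bsub>M\<^esub> L)"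
proof -
  interpret abelian_subgroup L M
    using assms by (intro abelian_subgroupI3 additive_subgroup.intro)
  show ?thesis
  proof (rule inj_onI)
    fix C D
    assume C: "C \<in> a_rcosets\<^bsub>M\<^esub> L" and D: "D \<in> a_rcosets\<^bsub>M\<^esub> L"
      and eq: "(SOME x. x \<in> C) = (SOME x. x \<in> D)"
    have "C \<noteq> {}" "D \<noteq> {}"
      using C D a_rcos_self unfolding A_RCOSETS_def' by blast+
    then have "(SOME x. x \<in> C) \<in> C" "(SOME x. x \<in> D) \<in> D"
      by (auto intro: someI_ex)
    with eq C D show "C = D"
      using a_rcos_disjoint unfolding pairwise_def disjnt_def by auto
  qed
qed

lemma quot_module:
  fixes R :: "('r, 'x) ring_scheme" and M :: "('r, 'm) module"
  assumes M: "left_module R M" and L: "submodule L R M"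
    and inj: "inj_on c (a_rcosets\<^bsub>M\<^esub> L)"
  shows quot_module_is_left_module: "left_module R (quot_module c M L)"
    and quot_proj_epi: "quot_proj c M L \<in> lmod_epi R M (quot_module c M L)"
    and quot_proj_kernel: "a_kernel M (quot_module c M L) (quot_proj c M L) = L"
proof -
  interpret M: left_module R M by (rule M)
  interpret submodule L R M by (rule L)
  interpret S: abelian_subgroup L M
    by (intro abelian_subgroupI3 additive_subgroup.intro M.abelian_group_axioms
        submodule.axioms(1)[OF L])
  let ?Q = "quot_module c M L" and ?p = "quot_proj c M L"
  have coset: "L +>\<^bsub>M\<^esub> x \<in> a_rcosets\<^bsub>M\<^esub> L" if "x \<in> carrier M" for x
    using that by (auto simp: A_RCOSETS_def')
  have decode: "the_inv_into (a_rcosets\<^bsub>M\<^esub> L) c (?p x) = L +>\<^bsub>M\<^esub> x" if "x \<in> carrier M" for x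
    using the_inv_into_f_f[OF inj coset[OF that]] by (simp add: quot_proj_def)
  have carr: "carrier ?Q = ?p ` carrier M"
    by (auto simp: quot_module_def transport_module_def coset_module_def quot_proj_def
        A_RCOSETS_def' Let_def)
  have zero: "\<zero>\<^bsub>?Q\<^esub> = ?p \<zero>\<^bsub>M\<^esub>"
    by (simp add: quot_module_def transport_module_def coset_module_def quot_proj_def Let_def
        S.a_subset)
  have add: "?p x \<oplus>\<^bsub>?Q\<^esub> ?p y = ?p (x \<oplus>\<^bsub>M\<^esub> y)" if "x \<in> carrier M" "y \<in> carrier M" for x y
    using decode[OF that(1)] decode[OF that(2)] S.a_rcos_sum[OF that]
    by (simp add: quot_module_def transport_module_def coset_module_def Let_def)
       (simp add: quot_proj_def)
  have smult_coset: "(\<Union>z\<in>L +>\<^bsub>M\<^esub> x. L +>\<^bsub>M\<^esub> (a \<odot>\<^bsub>M\<^esub> z)) = L +>\<^bsub>M\<^esub> (a \<odot>\<^bsub>M\<^esub> x)"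
    if a: "a \<in> carrier R" and x: "x \<in> carrier M" for a x
  proof -
    have "L +>\<^bsub>M\<^esub> (a \<odot>\<^bsub>M\<^esub> z) = L +>\<^bsub>M\<^esub> (a \<odot>\<^bsub>M\<^esub> x)" if z: "z \<in> L +>\<^bsub>M\<^esub> x" for z
    proof -
      obtain l where l: "l \<in> L" "z = l \<oplus>\<^bsub>M\<^esub> x"
        using z by (auto simp: a_r_coset_def')
      have lc: "l \<in> carrier M" using l S.a_subset by blast
      have "a \<odot>\<^bsub>M\<^esub> z = a \<odot>\<^bsub>M\<^esub> l \<oplus>\<^bsub>M\<^esub> a \<odot>\<^bsub>M\<^esub> x"
        using l lc a x M.smult_r_distr by blast
      moreover have "a \<odot>\<^bsub>M\<^esub> l \<in> L" using a l by blast
      ultimately have "a \<odot>\<^bsub>M\<^esub> z \<in> L +>\<^bsub>M\<^esub> (a \<odot>\<^bsub>M\<^esub> x)"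
        by (auto simp: a_r_coset_def')
      then show ?thesis
        using S.a_repr_independence' M.smult_closed[OF a x] by auto
    qed
    then show ?thesis using S.a_rcos_self[OF x] by blast
  qed
  have smult: "a \<odot>\<^bsub>?Q\<^esub> ?p x = ?p (a \<odot>\<^bsub>M\<^esub> x)" if "a \<in> carrier R" "x \<in> carrier M" for a x
    using decode[OF that(2)] smult_coset[OF that]
    by (simp add: quot_module_def transport_module_def coset_module_def Let_def)
       (simp add: quot_proj_def)
  have "abelian_group ?Q"
  proof (rule abelian_groupI)
    fix u assume "u \<in> carrier ?Q"
    then obtain x where x: "x \<in> carrier M" "u = ?p x" by (auto simp: carr)
    show "\<exists>v\<in>carrier ?Q. v \<oplus>\<^bsub>?Q\<^esub> u = \<zero>\<^bsub>?Q\<^esub>"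
      by (rule bexI[of _ "?p (\<ominus>\<^bsub>M\<^esub> x)"]) (use x in \<open>auto simp: add zero carr M.l_neg\<close>)
  qed (auto simp: carr zero add M.a_ac)
  then show "left_module R ?Q"
    by (intro left_module.intro left_module_axioms.intro M.ring_axioms)
       (auto simp: carr add smult M.smult_closed M.smult_l_distr M.smult_r_distr
          M.smult_assoc M.smult_one)
  show "?p \<in> lmod_epi R M ?Q"
    by (auto simp: lmod_epi_def lmod_hom_def carr add smult)
  have "?p x = ?p \<zero>\<^bsub>M\<^esub> \<longleftrightarrow> x \<in> L" if x: "x \<in> carrier M" for x
  proof -
    have "?p x = ?p \<zero>\<^bsub>M\<^esub> \<longleftrightarrow> L +>\<^bsub>M\<^esub> x = L +>\<^bsub>M\<^esub> \<zero>\<^bsub>M\<^esub>"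
      using inj_on_eq_iff[OF inj coset[OF x] coset[OF M.zero_closed]]
      by (simp add: quot_proj_def)
    also have "\<dots> \<longleftrightarrow> L +>\<^bsub>M\<^esub> x = L" by (simp add: S.a_subset)
    also have "\<dots> \<longleftrightarrow> x \<in> L"
      using S.a_rcos_self[OF x] S.a_rcos_const by auto
    finally show ?thesis .
  qed
  then show "a_kernel M ?Q ?p = L"
    using S.a_subset by (auto simp: a_kernel_def' zero)
qed

end

theory Submission
  imports Defs
begin

text \<open>
  Given a submodule selector \<open>\<alpha>\<close> and a surjection \<open>q : M \<rightarrow> P\<close>, the isomorphism
  \<open>M/ker q \<cong> P\<close> carries \<open>\<alpha>(M/ker q)\<close> to \<open>\<alpha>(P)\<close>, so \<open>(ker q)\<^sup>\<rho>\<close> is the preimage of \<open>\<alpha>(P)\<close> under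
  \<open>q\<close>.  Taking \<open>q\<close> to be the identity gives \<open>\<sigma>\<rho> = id\<close>, an arbitrary \<open>q\<close> gives residuality, and a
  projection composed with an isomorphism gives invariance.  Conversely, the residual property of
  \<open>r\<close> for the projection \<open>M \<rightarrow> M/L\<close> says precisely that \<open>\<rho>\<sigma> = id\<close>.
\<close>

section \<open>Homomorphisms of left modules\<close>

lemma lmod_hom_closed: "f \<in> lmod_hom R M N \<Longrightarrow> x \<in> carrier M \<Longrightarrow> f x \<in> carrier N"
  by (auto simp: lmod_hom_def)

lemma lmod_hom_add:
  "f \<in> lmod_hom R M N \<Longrightarrow> x \<in> carrier M \<Longrightarrow> y \<in> carrier M \<Longrightarrow> f (x \<oplus>\<^bsub>M\<^esub> y) = f x \<oplus>\<^bsub>N\<^esub> f y"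
  by (auto simp: lmod_hom_def)

lemma lmod_hom_smult:
  "f \<in> lmod_hom R M N \<Longrightarrow> a \<in> carrier R \<Longrightarrow> x \<in> carrier M \<Longrightarrow> f (a \<odot>\<^bsub>M\<^esub> x) = a \<odot>\<^bsub>N\<^esub> f x"
  by (auto simp: lmod_hom_def)

lemma lmod_epi_hom: "f \<in> lmod_epi R M N \<Longrightarrow> f \<in> lmod_hom R M N"
  by (simp add: lmod_epi_def)

lemma lmod_iso_epi: "f \<in> lmod_iso R M N \<Longrightarrow> f \<in> lmod_epi R M N"
  by (simp add: lmod_iso_def lmod_epi_def bij_betw_imp_surj_on)

lemma lmod_epi_id: "(\<lambda>x. x) \<in> lmod_epi R M M"
  by (auto simp: lmod_epi_def lmod_hom_def)

lemma lmod_epi_compose: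
  assumes f: "f \<in> lmod_epi R M N" and g: "g \<in> lmod_epi R N P"
  shows "g \<circ> f \<in> lmod_epi R M P"
proof -
  have "(g \<circ> f) ` carrier M = carrier P"
    using f g unfolding image_comp[symmetric] by (simp add: lmod_epi_def)
  then show ?thesis
    using f g by (auto simp: lmod_epi_def lmod_hom_def Pi_iff)
qed

section \<open>Submodules in additive notation and their transport along homomorphisms\<close>

lemma submoduleI:
  assumes "H \<subseteq> carrier M" and "\<zero>\<^bsub>M\<^esub> \<in> H"
    and "\<And>x y. x \<in> H \<Longrightarrow> y \<in> H \<Longrightarrow> x \<oplus>\<^bsub>M\<^esub> y \<in> H"
    and "\<And>x. x \<in> H \<Longrightarrow> \<ominus>\<^bsub>M\<^esub> x \<in> H"
    and "\<And>a x. a \<in> carrier R \<Longrightarrow> x \<in> H \<Longrightarrow> a \<odot>\<^bsub>M\<^esub> x \<in> H"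
  shows "submodule H R M"
  by (intro submodule.intro subgroup.intro submodule_axioms.intro)
     (use assms in \<open>auto simp: a_inv_def\<close>)

lemma submodule_subset: "submodule H R M \<Longrightarrow> H \<subseteq> carrier M"
  using subgroup.subset[OF submodule.axioms(1)] by fastforce

lemma submodule_zero: "submodule H R M \<Longrightarrow> \<zero>\<^bsub>M\<^esub> \<in> H"
  using subgroup.one_closed[OF submodule.axioms(1)] by fastforce

lemma submodule_add: "submodule H R M \<Longrightarrow> x \<in> H \<Longrightarrow> y \<in> H \<Longrightarrow> x \<oplus>\<^bsub>M\<^esub> y \<in> H"
  using subgroup.m_closed[OF submodule.axioms(1)] by fastforce

lemma submodule_neg: "submodule H R M \<Longrightarrow> x \<in> H \<Longrightarrow> \<ominus>\<^bsub>M\<^esub> x \<in> H"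
  using subgroup.m_inv_closed[OF submodule.axioms(1)] by (fastforce simp: a_inv_def)

lemma submodule_smult: "submodule H R M \<Longrightarrow> a \<in> carrier R \<Longrightarrow> x \<in> H \<Longrightarrow> a \<odot>\<^bsub>M\<^esub> x \<in> H"
  by (rule submodule.smult_closed)

text \<open>\<open>lmod_hom\<close> demands only additivity and compatibility with scalars.
  Preservation of zero and negatives is inherited from group homomorphisms through this view of the
  additive groups.\<close>

lemma lmod_hom_group_hom:
  assumes "left_module R M" "left_module R N" and f: "f \<in> lmod_hom R M N"
  shows "group_hom (add_monoid M) (add_monoid N) f"
proof -
  interpret M: left_module R M by fact
  interpret N: left_module R N by fact
  show ?thesis
    using f by unfold_locales (auto simp: lmod_hom_def hom_def)
qed

lemma lmod_hom_zero:
  assumes "left_module R M" "left_module R N" and "f \<in> lmod_hom R M N"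
  shows "f \<zero>\<^bsub>M\<^esub> = \<zero>\<^bsub>N\<^esub>"
  using group_hom.hom_one[OF lmod_hom_group_hom[OF assms]] by simp

lemma lmod_hom_neg:
  assumes "left_module R M" "left_module R N" and "f \<in> lmod_hom R M N" and "x \<in> carrier M"
  shows "f (\<ominus>\<^bsub>M\<^esub> x) = \<ominus>\<^bsub>N\<^esub> f x"
  using group_hom.hom_inv[OF lmod_hom_group_hom[OF assms(1-3)]] assms(4)
  by (simp add: a_inv_def)

lemma submodule_vimage:
  assumes M: "left_module R M" and N: "left_module R N" and f: "f \<in> lmod_hom R M N"
    and H: "submodule H R N"
  shows "submodule {x \<in> carrier M. f x \<in> H} R M"
proof -
  interpret M: left_module R M by (rule M)
  show ?thesis
    by (rule submoduleI)
       (auto simp: lmod_hom_zero[OF M N f] lmod_hom_neg[OF M N f] lmod_hom_add[OF f]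
          lmod_hom_smult[OF f] M.smult_closed
          intro: submodule_zero[OF H] submodule_add[OF H] submodule_neg[OF H]
            submodule_smult[OF H])
qed

lemma submodule_image:
  assumes M: "left_module R M" and N: "left_module R N" and f: "f \<in> lmod_hom R M N"
    and H: "submodule H R M"
  shows "submodule (f ` H) R N"
proof -
  have carr: "x \<in> carrier M" if "x \<in> H" for x
    using that submodule_subset[OF H] by blast
  show ?thesis
  proof (rule submoduleI)
    show "f ` H \<subseteq> carrier N"
      using carr lmod_hom_closed[OF f] by blast
    show "\<zero>\<^bsub>N\<^esub> \<in> f ` H"
      using submodule_zero[OF H] lmod_hom_zero[OF M N f] by force
  next
    fix x y assume "x \<in> f ` H" "y \<in> f ` H"
    then show "x \<oplus>\<^bsub>N\<^esub> y \<in> f ` H"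
      by (auto simp: lmod_hom_add[OF f, symmetric] carr intro: submodule_add[OF H])
  next
    fix x assume "x \<in> f ` H"
    then show "\<ominus>\<^bsub>N\<^esub> x \<in> f ` H"
      by (auto simp: lmod_hom_neg[OF M N f, symmetric] carr intro: submodule_neg[OF H])
  next
    fix a x assume "a \<in> carrier R" "x \<in> f ` H"
    then show "a \<odot>\<^bsub>N\<^esub> x \<in> f ` H"
      by (auto simp: lmod_hom_smult[OF f, symmetric] carr intro: submodule_smult[OF H])
  qed
qed

lemma submodule_zero_module:
  assumes M: "left_module R M"
  shows "submodule {\<zero>\<^bsub>M\<^esub>} R M"
proof -
  interpret left_module R M by (rule M)
  \<comment> \<open>Cancel one summand in a0 = a(0 + 0) = a0 + a0.\<close>
  have "a \<odot>\<^bsub>M\<^esub> \<zero>\<^bsub>M\<^esub> = \<zero>\<^bsub>M\<^esub>" if "a \<in> carrier R" for a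
    using smult_r_distr[OF that, of "\<zero>\<^bsub>M\<^esub>" "\<zero>\<^bsub>M\<^esub>"] smult_closed[OF that, of "\<zero>\<^bsub>M\<^esub>"]
    by (metis M.add.l_cancel_one' M.r_zero M.zero_closed)
  then show ?thesis
    by (intro submoduleI) auto
qed

section \<open>Kernels and the first isomorphism theorem\<close>

lemma submodule_kernel:
  assumes M: "left_module R M" and N: "left_module R N" and f: "f \<in> lmod_hom R M N"
  shows "submodule (a_kernel M N f) R M"
  using submodule_vimage[OF M N f submodule_zero_module[OF N]] by (simp add: a_kernel_def')

text \<open>The kernel alone decides which elements a map identifies, so two maps with the same
  kernel identify the same elements.\<close>

lemma lmod_hom_eq_iff:
  assumes M: "left_module R M" and N: "left_module R N" and f: "f \<in> lmod_hom R M N"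
    and x: "x \<in> carrier M" and y: "y \<in> carrier M"
  shows "f x = f y \<longleftrightarrow> x \<ominus>\<^bsub>M\<^esub> y \<in> a_kernel M N f"
proof -
  interpret M: left_module R M by (rule M)
  interpret N: left_module R N by (rule N)
  have "f (x \<ominus>\<^bsub>M\<^esub> y) = f x \<ominus>\<^bsub>N\<^esub> f y"
    using x y by (simp add: a_minus_def lmod_hom_add[OF f] lmod_hom_neg[OF M N f])
  then show ?thesis
    using x y lmod_hom_closed[OF f] N.add.right_cancel[of "\<ominus>\<^bsub>N\<^esub> f y" "f x" "f y"]
    by (simp add: a_kernel_def' a_minus_def N.r_neg)
qed

text \<open>Both targets are copies of M modulo the common kernel. Sending \<open>p x\<close> to
  \<open>q x\<close> is well defined and injective because \<open>p\<close> and \<open>q\<close>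
  identify the same elements.\<close>

lemma lmod_epi_same_kernel_iso:
  assumes M: "left_module R M" and N: "left_module R N" and P: "left_module R P"
    and p: "p \<in> lmod_epi R M N" and q: "q \<in> lmod_epi R M P"
    and ker: "a_kernel M N p = a_kernel M P q"
  obtains h where "h \<in> lmod_iso R N P" and "\<And>x. x \<in> carrier M \<Longrightarrow> h (p x) = q x"
proof -
  interpret M: left_module R M by (rule M)
  note p' = lmod_epi_hom[OF p] and q' = lmod_epi_hom[OF q]
  have eq: "p x = p y \<longleftrightarrow> q x = q y" if "x \<in> carrier M" "y \<in> carrier M" for x y
    using that lmod_hom_eq_iff[OF M N p'] lmod_hom_eq_iff[OF M P q'] ker by simp
  have N_eq: "carrier N = p ` carrier M" and P_eq: "carrier P = q ` carrier M"
    using p q by (auto simp: lmod_epi_def)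
  \<comment> \<open>Any preimage under \<open>p\<close> would do: by \<open>eq\<close>,
    \<open>q\<close> takes the same value on all of them.\<close>
  define h where "h = q \<circ> inv_into (carrier M) p"
  have h: "h (p x) = q x" if x: "x \<in> carrier M" for x
    using eq[of "inv_into (carrier M) p (p x)" x] x
    by (simp add: h_def inv_into_into f_inv_into_f)
  have "h \<in> lmod_hom R N P"
    by (auto simp: lmod_hom_def N_eq h lmod_hom_closed[OF q'] M.smult_closed
        lmod_hom_add[OF p', symmetric] lmod_hom_add[OF q', symmetric]
        lmod_hom_smult[OF p', symmetric] lmod_hom_smult[OF q', symmetric])
  moreover have "bij_betw h (carrier N) (carrier P)"
    by (auto simp: bij_betw_def inj_on_def N_eq P_eq h eq image_image)
  ultimately have "h \<in> lmod_iso R N P"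
    by (simp add: lmod_iso_def)
  with h show ?thesis by (rule that[rotated])
qed

section \<open>Selectors and residual operations\<close>

text \<open>One coding \<open>c\<close> serves all modules and submodules, but injectivity is asked
  only on the cosets of one submodule at a time; cosets of different submodules may share a
  name.\<close>

locale module_class =
  fixes R :: "('r, 'x) ring_scheme"
    and \<M> :: "('r, 'm) module set"
    and c :: "'m set \<Rightarrow> 'm"
  assumes modules: "M \<in> \<M> \<Longrightarrow> left_module R M"
    and coding: "M \<in> \<M> \<Longrightarrow> submodule L R M \<Longrightarrow> inj_on c (a_rcosets\<^bsub>M\<^esub> L)"
    and submodules: "closed_under_submodules R \<M>"
    and quotients: "closed_under_quotients R c \<M>"
begin

lemma quot_in: "M \<in> \<M> \<Longrightarrow> submodule L R M \<Longrightarrow> quot_module c M L \<in> \<M>"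
  using quotients by (auto simp: closed_under_quotients_def)

lemma quot_epi:
  "M \<in> \<M> \<Longrightarrow> submodule L R M \<Longrightarrow> quot_proj c M L \<in> lmod_epi R M (quot_module c M L)"
  using quot_proj_epi[OF modules _ coding] by blast

lemma quot_kernel:
  "M \<in> \<M> \<Longrightarrow> submodule L R M \<Longrightarrow> a_kernel M (quot_module c M L) (quot_proj c M L) = L"
  using quot_proj_kernel[OF modules _ coding] by blast

section \<open>From selectors to residual operations\<close>

lemma residual_of_eq:
  "M \<in> \<M> \<Longrightarrow> submodule L R M \<Longrightarrow>
    residual_of R c \<M> \<alpha> (L, M) = {x \<in> carrier M. quot_proj c M L x \<in> \<alpha> (quot_module c M L)}"
  by (simp add: residual_of_def submodule_pairs_def)

text \<open>The right-hand side involves neither \<open>c\<close> nor the chosen quotient. Any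
  surjection with the right kernel may thus replace the natural projection, which the next lemmas
  exploit.\<close>

lemma residual_of_kernel:
  assumes \<alpha>: "\<alpha> \<in> submodule_selectors R \<M>"
    and M: "M \<in> \<M>" and P: "P \<in> \<M>" and q: "q \<in> lmod_epi R M P"
  shows "residual_of R c \<M> \<alpha> (a_kernel M P q, M) = {x \<in> carrier M. q x \<in> \<alpha> P}"
proof -
  let ?K = "a_kernel M P q"
  let ?Q = "quot_module c M ?K" and ?p = "quot_proj c M ?K"
  have K: "submodule ?K R M"
    by (rule submodule_kernel[OF modules[OF M] modules[OF P] lmod_epi_hom[OF q]])
  note Q = quot_in[OF M K] and p = quot_epi[OF M K]
  obtain h where h: "h \<in> lmod_iso R ?Q P" and hp: "\<And>x. x \<in> carrier M \<Longrightarrow> h (?p x) = q x"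
    using lmod_epi_same_kernel_iso[OF modules[OF M] modules[OF Q] modules[OF P] p q
        quot_kernel[OF M K]] by blast
  have image: "h ` \<alpha> ?Q = \<alpha> P" and sub: "\<alpha> ?Q \<subseteq> carrier ?Q"
    using \<alpha> Q P h by (auto simp: submodule_selectors_def dest!: submodule_subset)
  have inj: "inj_on h (carrier ?Q)"
    using h by (simp add: lmod_iso_def bij_betw_def)
  \<comment> \<open>Injectivity of \<open>h\<close> on the whole carrier is what gives the direction
    from \<open>q x\<close> back to \<open>?p x\<close>.\<close>
  have "?p x \<in> \<alpha> ?Q \<longleftrightarrow> q x \<in> \<alpha> P" if x: "x \<in> carrier M" for x
    using inj_on_image_mem_iff[OF inj lmod_hom_closed[OF lmod_epi_hom[OF p] x] sub] hp[OF x] image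
    by simp
  then show ?thesis
    by (auto simp: residual_of_eq[OF M K])
qed

text \<open>The coded quotient M/0 is in general only isomorphic to M, so the identity map, with
  kernel zero, takes the place of the projection.\<close>

lemma residual_of_zero:
  assumes \<alpha>: "\<alpha> \<in> submodule_selectors R \<M>" and M: "M \<in> \<M>"
  shows "residual_of R c \<M> \<alpha> ({\<zero>\<^bsub>M\<^esub>}, M) = \<alpha> M"
proof -
  interpret left_module R M by (rule modules[OF M])
  have "a_kernel M M (\<lambda>x. x) = {\<zero>\<^bsub>M\<^esub>}"
    by (auto simp: a_kernel_def')
  moreover have "\<alpha> M \<subseteq> carrier M"
    using \<alpha> M by (auto simp: submodule_selectors_def dest!: submodule_subset)
  ultimately show ?thesis
    using residual_of_kernel[OF \<alpha> M M lmod_epi_id] by auto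
qed

lemma residual_of_iso:
  assumes \<alpha>: "\<alpha> \<in> submodule_selectors R \<M>"
    and M: "M \<in> \<M>" and N: "N \<in> \<M>" and f: "f \<in> lmod_iso R M N" and L: "submodule L R M"
  shows "f ` residual_of R c \<M> \<alpha> (L, M) = residual_of R c \<M> \<alpha> (f ` L, N)"
proof -
  let ?Q = "quot_module c N (f ` L)" and ?p = "quot_proj c N (f ` L)"
  note epi = lmod_iso_epi[OF f] and hom = lmod_epi_hom[OF lmod_iso_epi[OF f]]
  have fL: "submodule (f ` L) R N"
    by (rule submodule_image[OF modules[OF M] modules[OF N] hom L])
  have inj: "inj_on f (carrier M)" and surj: "f ` carrier M = carrier N"
    using f by (auto simp: lmod_iso_def bij_betw_def)
  have "a_kernel M ?Q (?p \<circ> f) = {x \<in> carrier M. f x \<in> f ` L}"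
    using quot_kernel[OF N fL] lmod_hom_closed[OF hom] by (auto simp: a_kernel_def')
  also have "\<dots> = L"
    using inj_on_image_mem_iff[OF inj] submodule_subset[OF L] by blast
  finally have "residual_of R c \<M> \<alpha> (L, M) = {x \<in> carrier M. ?p (f x) \<in> \<alpha> ?Q}"
    using residual_of_kernel[OF \<alpha> M quot_in[OF N fL] lmod_epi_compose[OF epi quot_epi[OF N fL]]]
    by simp
  \<comment> \<open>Since \<open>f\<close> is onto, the image of a preimage under \<open>f\<close>
    is the original subset of N.\<close>
  then show ?thesis
    by (auto simp: residual_of_eq[OF N fL] surj[symmetric])
qed

lemma residual_of_residual:
  assumes \<alpha>: "\<alpha> \<in> submodule_selectors R \<M>"
  shows "residual_of R c \<M> \<alpha> \<in> residual_operations R \<M>"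
proof -
  let ?r = "residual_of R c \<M> \<alpha>"
  have "L \<subseteq> ?r (L, M)" "submodule (?r (L, M)) R M" "M\<lparr>carrier := ?r (L, M)\<rparr> \<in> \<M>"
    if M: "M \<in> \<M>" and L: "submodule L R M" for L M
  proof -
    note Q = quot_in[OF M L]
    have sub: "submodule (\<alpha> (quot_module c M L)) R (quot_module c M L)"
      using \<alpha> Q by (auto simp: submodule_selectors_def)
    \<comment> \<open>The projection kills L, its kernel, and zero lies in every submodule.\<close>
    show "L \<subseteq> ?r (L, M)"
      using submodule_zero[OF sub]
      by (subst quot_kernel[OF M L, symmetric]) (auto simp: residual_of_eq[OF M L] a_kernel_def')
    show r: "submodule (?r (L, M)) R M"
      using submodule_vimage[OF modules[OF M] modules[OF Q] lmod_epi_hom[OF quot_epi[OF M L]] sub]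
      by (simp add: residual_of_eq[OF M L])
    show "M\<lparr>carrier := ?r (L, M)\<rparr> \<in> \<M>"
      using submodules M r by (auto simp: closed_under_submodules_def)
  qed
  then have "?r \<in> extensive_operations R \<M>"
    by (auto simp: extensive_operations_def submodule_pairs_def residual_of_iso[OF \<alpha>])
       \<comment> \<open>What remains is extensionality, which holds because
         \<open>residual_of\<close> is a restricted function.\<close>
       (simp add: residual_of_def submodule_pairs_def)
  then show ?thesis
    by (simp add: residual_operations_def residual_of_kernel[OF \<alpha>] residual_of_zero[OF \<alpha>])
qed

lemma selector_of_residual_of:
  assumes \<alpha>: "\<alpha> \<in> submodule_selectors R \<M>"
  shows "selector_of \<M> (residual_of R c \<M> \<alpha>) = \<alpha>"
proof (rule extensionalityI)
  show "\<alpha> \<in> extensional \<M>"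
    using \<alpha> by (simp add: submodule_selectors_def)
qed (simp_all add: selector_of_def residual_of_zero[OF \<alpha>])

section \<open>From residual operations to selectors and back\<close>

lemma selector_of_selector:
  assumes r: "r \<in> residual_operations R \<M>"
  shows "selector_of \<M> r \<in> submodule_selectors R \<M>"
proof -
  have pair: "({\<zero>\<^bsub>M\<^esub>}, M) \<in> submodule_pairs R \<M>" if "M \<in> \<M>" for M
    using that submodule_zero_module[OF modules[OF that]] by (simp add: submodule_pairs_def)
  have ext: "r \<in> extensive_operations R \<M>"
    using r by (simp add: residual_operations_def)
  have "f ` r ({\<zero>\<^bsub>M\<^esub>}, M) = r ({\<zero>\<^bsub>N\<^esub>}, N)"
    if M: "M \<in> \<M>" and N: "N \<in> \<M>" and f: "f \<in> lmod_iso R M N" for M N f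
  proof -
    have "f ` r ({\<zero>\<^bsub>M\<^esub>}, M) = r (f ` {\<zero>\<^bsub>M\<^esub>}, N)"
      using ext M N f submodule_zero_module[OF modules[OF M]]
      by (auto simp: extensive_operations_def)
    \<comment> \<open>An isomorphism maps the zero submodule onto the zero submodule.\<close>
    then show ?thesis
      using lmod_hom_zero[OF modules[OF M] modules[OF N] lmod_epi_hom[OF lmod_iso_epi[OF f]]]
      by simp
  qed
  moreover have "submodule (r ({\<zero>\<^bsub>M\<^esub>}, M)) R M" "M\<lparr>carrier := r ({\<zero>\<^bsub>M\<^esub>}, M)\<rparr> \<in> \<M>"
    if "M \<in> \<M>" for M
    using ext pair[OF that] by (auto simp: extensive_operations_def)
  ultimately show ?thesis
    by (simp add: submodule_selectors_def selector_of_def)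
qed

lemma residual_of_selector_of:
  assumes r: "r \<in> residual_operations R \<M>"
  shows "residual_of R c \<M> (selector_of \<M> r) = r"
proof (rule extensionalityI)
  show "residual_of R c \<M> (selector_of \<M> r) \<in> extensional (submodule_pairs R \<M>)"
    by (simp add: residual_of_def)
  show "r \<in> extensional (submodule_pairs R \<M>)"
    using r by (simp add: residual_operations_def extensive_operations_def)
  fix z assume "z \<in> submodule_pairs R \<M>"
  then obtain L M where z: "z = (L, M)" and M: "M \<in> \<M>" and L: "submodule L R M"
    by (auto simp: submodule_pairs_def)
  note Q = quot_in[OF M L]
  \<comment> \<open>This is the residual property for the natural projection, available because the
    quotient belongs to the class. Its kernel is L, so the equation is the claim once
    \<open>selector_of\<close> is unfolded.\<close>
  have "r (a_kernel M (quot_module c M L) (quot_proj c M L), M) =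
      {x \<in> carrier M. quot_proj c M L x \<in> r ({\<zero>\<^bsub>quot_module c M L\<^esub>}, quot_module c M L)}"
    using r M Q quot_epi[OF M L] by (auto simp: residual_operations_def)
  then show "residual_of R c \<M> (selector_of \<M> r) z = r z"
    by (simp add: z residual_of_eq[OF M L] selector_of_def Q quot_kernel[OF M L])
qed

end

theorem proposition2p4:
  fixes R :: "('r, 'x) ring_scheme"
    and \<M> :: "('r, 'm) module set"
    and c :: "'m set \<Rightarrow> 'm"
  assumes "ring R"
    and "\<And>M. M \<in> \<M> \<Longrightarrow> left_module R M"
    and "\<And>M L. M \<in> \<M> \<Longrightarrow> submodule L R M \<Longrightarrow> inj_on c (a_rcosets\<^bsub>M\<^esub> L)"
    and "closed_under_submodules R \<M>"
    and "closed_under_quotients R c \<M>"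
  shows "bij_betw (selector_of \<M>) (residual_operations R \<M>) (submodule_selectors R \<M>) \<and>
    (\<forall>r\<in>residual_operations R \<M>. residual_of R c \<M> (selector_of \<M> r) = r) \<and>
    (\<forall>\<alpha>\<in>submodule_selectors R \<M>. residual_of R c \<M> \<alpha> \<in> residual_operations R \<M> \<and>
       selector_of \<M> (residual_of R c \<M> \<alpha>) = \<alpha>)"
proof -
  interpret module_class R \<M> c
    by (intro module_class.intro assms(2-5))
  have "bij_betw (selector_of \<M>) (residual_operations R \<M>) (submodule_selectors R \<M>)"
    by (rule bij_betw_byWitness[where f' = "residual_of R c \<M>"])
       (auto simp: residual_of_selector_of selector_of_residual_of selector_of_selector
          residual_of_residual)
  then show ?thesis
    by (simp add: residual_of_selector_of selector_of_residual_of residual_of_residual)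
qed

end
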